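(* Let $n\in\mathbb N$, $n\ge 1$, let $Q=2n+2$, and let $M:\mathbb R_+\times\mathbb R_+\to\mathbb R$ be a bounded function such that $0<M(\cdot,\cdot)\le C_0$ for some constant $C_0$. If $$1<p\le \frac{Q}{Q-2},$$ then the Kirchhoff type elliptic equation $$-M\left(\int_{\mathbb H^n}|\nabla_{\mathbb H}u|^2dx,\int_{\mathbb H^n}|\Delta_{\mathbb H}u|^2dx\right)\Delta_{\mathbb H}u(x)=|u(x)|^p,\qquad x\in\mathbb H^n,$$ does not have a global non-trivial weak solution (i.e. every weak solution on the whole of $\mathbb H^n$ vanishes almost everywhere).
   Context: $\mathbb R_+=[0,\infty)$. The Heisenberg group $\mathbb H^n$ is $\mathbb R^{2n+1}$ with points $x=(\xi,\tilde\xi,\tau)$, $\xi,\tilde\xi\in\mathbb R^n$, $\tau\in\mathbb R$, equipped with the vector fields $X_i=\partial_{\xi_i}+2\tilde\xi_i\partial_\tau$, $Y_i=\partial_{\tilde\xi_i}-2\xi_i\partial_\tau$ ($i=1,\dots,n$) and with Lebesgue measure $dx$; its homogeneous dimension is $Q=2n+2$ (dilations $\delta_\lambda(x)=(\lambda\xi,\lambda\tilde\xi,\lambda^2\tau)$). The horizontal gradient is $\nabla_{\mathbb H}=(X_1,\dots,X_n,Y_1,\dots,Y_n)$ and the Kohn-Laplacian is $\Delta_{\mathbb H}=\sum_{i=1}^n(X_i^2+Y_i^2)$. $S^2_2(\mathbb H^n)=\{u: u\in L^2(\mathbb H^n),\ |\nabla_{\mathbb H}u|\in L^2(\mathbb H^n),\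 |\Delta_{\mathbb H}u|\in L^2(\mathbb H^n)\}$ (derivatives in the distributional sense). Definition. A function $u\in S^2_2(\mathbb H^n)\cap L^p(\mathbb H^n)$ is a weak solution of the equation if $$\int_{\mathbb H^n}|u|^p\varphi\,dx=-\int_{\mathbb H^n}M\left(\int_{\mathbb H^n}|\nabla_{\mathbb H}u|^2dx,\int_{\mathbb H^n}|\Delta_{\mathbb H}u|^2dx\right)u\,\Delta_{\mathbb H}\varphi\,dx$$ for every test function $0\le\varphi\in C_0^2(\mathbb H^n)$ (compactly supported $C^2$ functions). *)

theory Defs
  imports "HOL-Analysis.Analysis"
begin

type_synonym 'n heis = "(real^'n) \<times> (real^'n) \<times> real"

text \<open>The argument \<open>(\<xi>, \<eta>, \<tau>)\<close> below stands for the point usually written with components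
  xi, xi-tilde and tau. The fields \<open>X\<^sub>i = \<partial>/\<partial>\<xi>\<^sub>i + 2 \<eta>\<^sub>i \<partial>/\<partial>\<tau>\<close> and
  \<open>Y\<^sub>i = \<partial>/\<partial>\<eta>\<^sub>i - 2 \<xi>\<^sub>i \<partial>/\<partial>\<tau>\<close> are identified with their coefficient vectors, and act on
  differentiable functions as directional derivatives.\<close>

definition X_field :: "'n::finite \<Rightarrow> 'n heis \<Rightarrow> 'n heis" where
  "X_field i = (\<lambda>(\<xi>, \<eta>, \<tau>). (axis i 1, 0, 2 * \<eta> $ i))"

definition Y_field :: "'n::finite \<Rightarrow> 'n heis \<Rightarrow> 'n heis" where
  "Y_field i = (\<lambda>(\<xi>, \<eta>, \<tau>). (0, axis i 1, - 2 * \<xi> $ i))"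

definition lie_deriv :: "('a::real_normed_vector \<Rightarrow> 'a) \<Rightarrow> ('a \<Rightarrow> real) \<Rightarrow> 'a \<Rightarrow> real" where
  "lie_deriv V f x = frechet_derivative f (at x) (V x)"

definition kohn_laplacian :: "('n::finite heis \<Rightarrow> real) \<Rightarrow> 'n heis \<Rightarrow> real" where
  "kohn_laplacian f x =
     (\<Sum>i\<in>UNIV. lie_deriv (X_field i) (lie_deriv (X_field i) f) x
              + lie_deriv (Y_field i) (lie_deriv (Y_field i) f) x)"

text \<open>In finite dimension, a function is of class C^(k+1) iff it is differentiable
  and all its derivatives in constant directions are of class C^k.\<close>

primrec Ck :: "nat \<Rightarrow> ('a::euclidean_space \<Rightarrow> real) \<Rightarrow> bool" where
  "Ck 0 f \<longleftrightarrow> continuous_on UNIV f"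
| "Ck (Suc k) f \<longleftrightarrow>
     (\<forall>x. f differentiable (at x)) \<and> (\<forall>v. Ck k (\<lambda>x. frechet_derivative f (at x) v))"

definition compactly_supported :: "('a::euclidean_space \<Rightarrow> real) \<Rightarrow> bool" where
  "compactly_supported f \<longleftrightarrow> compact (closure {x. f x \<noteq> 0})"

definition Ck_compact :: "nat \<Rightarrow> ('a::euclidean_space \<Rightarrow> real) set" where
  "Ck_compact k = {f. Ck k f \<and> compactly_supported f}"

definition Cinf_compact :: "('a::euclidean_space \<Rightarrow> real) set" where
  "Cinf_compact = {f. (\<forall>k. Ck k f) \<and> compactly_supported f}"

definition Lp_space :: "real \<Rightarrow> ('a::euclidean_space \<Rightarrow> 'b::euclidean_space) set" where
  "Lp_space p = {f \<in> borel_measurable lebesgue. integrable lebesgue (\<lambda>x. norm (f x) powr p)}"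

definition locally_integrable :: "('a::euclidean_space \<Rightarrow> 'b::euclidean_space) \<Rightarrow> bool" where
  "locally_integrable f \<longleftrightarrow> (\<forall>K. compact K \<longrightarrow> f absolutely_integrable_on K)"

text \<open>The fields \<open>X\<^sub>i\<close> and \<open>Y\<^sub>i\<close> are divergence free, so their formal adjoints are \<open>- X\<^sub>i\<close> and
  \<open>- Y\<^sub>i\<close>, and the Kohn Laplacian is formally self-adjoint. This gives the signs in the
  distributional identities. The two components of a horizontal gradient collect the derivatives
  along the \<open>X\<^sub>i\<close> and along the \<open>Y\<^sub>i\<close>; its product norm is the Euclidean one.\<close>

definition has_weak_hgrad ::
    "('n::finite heis \<Rightarrow> real) \<Rightarrow> ('n heis \<Rightarrow> (real^'n) \<times> (real^'n)) \<Rightarrow> bool" where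
  "has_weak_hgrad u g \<longleftrightarrow>
     locally_integrable u \<and> locally_integrable g \<and>
     (\<forall>\<phi>\<in>Cinf_compact. \<forall>i.
        (\<integral>x. fst (g x) $ i * \<phi> x \<partial>lebesgue)
          = - (\<integral>x. u x * lie_deriv (X_field i) \<phi> x \<partial>lebesgue) \<and>
        (\<integral>x. snd (g x) $ i * \<phi> x \<partial>lebesgue)
          = - (\<integral>x. u x * lie_deriv (Y_field i) \<phi> x \<partial>lebesgue))"

definition has_weak_kohn_laplacian ::
    "('n::finite heis \<Rightarrow> real) \<Rightarrow> ('n heis \<Rightarrow> real) \<Rightarrow> bool" where
  "has_weak_kohn_laplacian u w \<longleftrightarrow>
     locally_integrable u \<and> locally_integrable w \<and>
     (\<forall>\<phi>\<in>Cinf_compact.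
        (\<integral>x. w x * \<phi> x \<partial>lebesgue) = (\<integral>x. u x * kohn_laplacian \<phi> x \<partial>lebesgue))"

text \<open>Weak derivatives are unique up to null sets; the following are arbitrary representatives,
  meaningful only when a weak derivative exists.\<close>

definition weak_hgrad :: "('n::finite heis \<Rightarrow> real) \<Rightarrow> 'n heis \<Rightarrow> (real^'n) \<times> (real^'n)" where
  "weak_hgrad u = (SOME g. has_weak_hgrad u g)"

definition weak_kohn_laplacian :: "('n::finite heis \<Rightarrow> real) \<Rightarrow> 'n heis \<Rightarrow> real" where
  "weak_kohn_laplacian u = (SOME w. has_weak_kohn_laplacian u w)"

definition S22 :: "('n::finite heis \<Rightarrow> real) set" where
  "S22 = {u. u \<in> Lp_space 2 \<and>
             (\<exists>g. has_weak_hgrad u g) \<and> weak_hgrad u \<in> Lp_space 2 \<and>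
             (\<exists>w. has_weak_kohn_laplacian u w) \<and> weak_kohn_laplacian u \<in> Lp_space 2}"

definition kirchhoff_weak_solution ::
    "(real \<Rightarrow> real \<Rightarrow> real) \<Rightarrow> real \<Rightarrow> ('n::finite heis \<Rightarrow> real) \<Rightarrow> bool" where
  "kirchhoff_weak_solution M p u \<longleftrightarrow>
     u \<in> S22 \<inter> Lp_space p \<and>
     (\<forall>\<phi>\<in>Ck_compact 2. (\<forall>x. 0 \<le> \<phi> x) \<longrightarrow>
        (\<integral>x. \<bar>u x\<bar> powr p * \<phi> x \<partial>lebesgue)
          = - (\<integral>x. M (\<integral>y. (norm (weak_hgrad u y))\<^sup>2 \<partial>lebesgue)
                      (\<integral>y. \<bar>weak_kohn_laplacian u y\<bar>\<^sup>2 \<partial>lebesgue)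
                    * u x * kohn_laplacian \<phi> x \<partial>lebesgue))"

end

theory Submission
  imports Defs
begin

text \<open>
  Write \<open>\<rho> = (|\<xi>|\<^sup>2 + |\<eta>|\<^sup>2)\<^sup>2 + \<tau>\<^sup>2\<close> and test the equation with \<open>\<phi>\<^sub>R = max 0 (1 - \<rho> / R^4) ^ 3\<close>. Its Kohn
  Laplacian is at most a constant times \<open>w\<^sub>R / R\<^sup>2\<close>, where \<open>w\<^sub>R = (|\<xi>|\<^sup>2 + |\<eta>|\<^sup>2) / R\<^sup>2\<close> on the Koranyi
  ball \<open>\<rho> \<le> R^4\<close>, of volume \<open>O(R^Q)\<close>, and \<open>w\<^sub>R = 0\<close> outside. Young's inequality for
  the conjugate exponents \<open>p, q\<close>, with a parameter \<open>s\<close>, gives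
  \<open>\<integral>|u|^p \<phi>\<^sub>R \<le> K (s^p \<integral>|u|^p w\<^sub>R + s^(-q) R^(Q - 2 q))\<close>, where \<open>Q \<le> 2 q\<close> by the assumption on \<open>p\<close>. Since
  \<open>u\<close> lies in \<open>L^p\<close>, and \<open>0 \<le> w\<^sub>R \<le> 1\<close> tends to 0 pointwise, letting first \<open>R\<close> and then \<open>s\<close> tend to
  infinity yields \<open>\<integral>|u|^p = 0\<close>, also in the critical case \<open>Q = 2 q\<close>.
\<close>

section \<open>Differentiation rules for explicit derivatives and truncated powers\<close>

lemma Ck_Suc_iff:
  assumes "\<And>x. (f has_derivative f' x) (at x)"
  shows "Ck (Suc k) f \<longleftrightarrow> (\<forall>v. Ck k (\<lambda>x. f' x v))"
proof -
  have "frechet_derivative f (at x) = f' x" for x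
    using frechet_derivative_at[OF assms] by metis
  with assms show ?thesis
    by (auto simp: differentiable_def)
qed

lemma lie_deriv_eq:
  assumes "(f has_derivative f') (at x)"
  shows "lie_deriv V f x = f' (V x)"
  using frechet_derivative_at[OF assms] by (simp add: lie_deriv_def)

text \<open>At 0 the difference quotient is \<open>max 0 h ^ Suc k\<close>, which tends to 0; away
  from 0 the function is locally either zero or a monomial. Used for the powers 3 and then 2, this
  makes the cube in \<open>cutoff\<close> twice continuously differentiable.\<close>

lemma DERIV_max_0_power:
  "((\<lambda>y::real. max 0 y ^ Suc (Suc k)) has_real_derivative real (Suc (Suc k)) * max 0 y ^ Suc k) (at y)"
proof -
  consider "y < 0" | "y = 0" | "y > 0" by linarith
  then show ?thesis
  proof cases
    case 1
    have "((\<lambda>y::real. 0) has_real_derivative 0) (at y)" by simp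
    then have "((\<lambda>y::real. max 0 y ^ Suc (Suc k)) has_real_derivative 0) (at y)"
      by (rule has_field_derivative_transform_within_open[where S="{..<0}"]) (use 1 in auto)
    with 1 show ?thesis by simp
  next
    case 2
    have "isCont (\<lambda>h::real. max 0 h ^ Suc k) 0"
      by (intro continuous_intros)
    then have "((\<lambda>h::real. max 0 h ^ Suc k) \<longlongrightarrow> 0) (at 0)"
      by (simp add: isCont_def)
    moreover have "\<forall>\<^sub>F h in at (0::real). max 0 h ^ Suc k = max 0 h ^ Suc (Suc k) / h"
      by (auto simp: eventually_at_filter max_def)
    ultimately have "((\<lambda>h::real. max 0 h ^ Suc (Suc k) / h) \<longlongrightarrow> 0) (at 0)"
      by (rule Lim_transform_eventually)
    with 2 show ?thesis
      by (simp add: DERIV_def)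
  next
    case 3
    have "((\<lambda>y::real. y ^ Suc (Suc k)) has_real_derivative real (Suc (Suc k)) * y ^ Suc k) (at y)"
      using DERIV_pow[of "Suc (Suc k)" y] by simp
    then have "((\<lambda>y::real. max 0 y ^ Suc (Suc k)) has_real_derivative real (Suc (Suc k)) * y ^ Suc k) (at y)"
      by (rule has_field_derivative_transform_within_open[where S="{0<..}"]) (use 3 in auto)
    with 3 show ?thesis by simp
  qed
qed

lemma has_derivative_max_0_power:
  fixes h :: "'a::real_normed_vector \<Rightarrow> real"
  assumes "(h has_derivative h') (at x)"
  shows "((\<lambda>x. max 0 (h x) ^ Suc (Suc k)) has_derivative
           (\<lambda>v. real (Suc (Suc k)) * max 0 (h x) ^ Suc k * h' v)) (at x)"
  using has_derivative_compose[OF assms has_field_derivative_imp_has_derivative[OF DERIV_max_0_power]]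
  by simp

section \<open>The Koranyi gauge and its derivatives\<close>

definition hsq :: "'n::finite heis \<Rightarrow> real" where
  "hsq x = fst x \<bullet> fst x + fst (snd x) \<bullet> fst (snd x)"

text \<open>This is the fourth power of the Koranyi gauge, homogeneous of degree 4 under the
  dilations. Unlike the gauge itself, it is a polynomial and hence smooth at the origin.\<close>

definition gauge4 :: "'n::finite heis \<Rightarrow> real" where
  "gauge4 x = (hsq x)\<^sup>2 + (snd (snd x))\<^sup>2"

definition dhsq :: "'n::finite heis \<Rightarrow> 'n heis \<Rightarrow> real" where
  "dhsq x v = 2 * (fst x \<bullet> fst v) + 2 * (fst (snd x) \<bullet> fst (snd v))"

definition dgauge4 :: "'n::finite heis \<Rightarrow> 'n heis \<Rightarrow> real" where
  "dgauge4 x v = 2 * hsq x * dhsq x v + 2 * snd (snd x) * snd (snd v)"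

lemma has_derivative_hsq: "(hsq has_derivative dhsq x) (at x)"
  unfolding hsq_def[abs_def] dhsq_def[abs_def]
  by (auto intro!: derivative_eq_intros simp: inner_commute fun_eq_iff)

lemma has_derivative_gauge4: "(gauge4 has_derivative dgauge4 x) (at x)"
  unfolding gauge4_def[abs_def] dgauge4_def[abs_def]
  by (auto intro!: derivative_eq_intros has_derivative_hsq simp: fun_eq_iff)

lemma continuous_on_hsq [continuous_intros]:
  "continuous_on S f \<Longrightarrow> continuous_on S (\<lambda>x. hsq (f x))"
  unfolding hsq_def by (intro continuous_intros)

lemma continuous_on_gauge4 [continuous_intros]:
  "continuous_on S f \<Longrightarrow> continuous_on S (\<lambda>x. gauge4 (f x))"
  unfolding gauge4_def by (intro continuous_intros)

lemma hsq_nonneg [simp]: "0 \<le> hsq x"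
  by (simp add: hsq_def)

lemma hsq_le_gauge4: "(hsq x)\<^sup>2 \<le> gauge4 x"
  by (simp add: gauge4_def)

lemma gauge4_nonneg [simp]: "0 \<le> gauge4 x"
  by (simp add: gauge4_def)

section \<open>The test functions and a pointwise bound for their Kohn Laplacian\<close>

definition cutoff :: "real \<Rightarrow> 'n::finite heis \<Rightarrow> real" where
  "cutoff R x = max 0 (1 - gauge4 x / R ^ 4) ^ 3"

lemma has_derivative_one_minus_gauge4:
  "((\<lambda>x. 1 - gauge4 x / R ^ 4) has_derivative (\<lambda>v. - (dgauge4 x v / R ^ 4))) (at x)"
  using has_derivative_diff[OF has_derivative_const[of 1]
      bounded_linear.has_derivative[OF bounded_linear_divide[of "R ^ 4"] has_derivative_gauge4[of x]]]
  by simp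

lemma has_derivative_cutoff:
  "(cutoff R has_derivative (\<lambda>v. - (3 / R ^ 4 * max 0 (1 - gauge4 x / R ^ 4) ^ 2 * dgauge4 x v))) (at x)"
  using has_derivative_max_0_power[OF has_derivative_one_minus_gauge4[of R x], of 1]
  by (simp add: cutoff_def[abs_def] numeral_eq_Suc)

text \<open>The factor \<open>D\<close> is left general to serve two purposes: with the derivative
  of \<open>gauge4\<close> in a constant direction it gives the C^2 property, and with its
  derivative along a field \<open>X_field i\<close> or \<open>Y_field i\<close>, whose coefficients
  vary, it gives the iterated Lie derivatives.\<close>

lemma has_derivative_deriv_cutoff:
  assumes "(D has_derivative D') (at x)"
  shows "((\<lambda>x. - (3 / R ^ 4 * max 0 (1 - gauge4 x / R ^ 4) ^ 2 * D x)) has_derivative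
     (\<lambda>w. 6 / R ^ 8 * max 0 (1 - gauge4 x / R ^ 4) * dgauge4 x w * D x
        - 3 / R ^ 4 * max 0 (1 - gauge4 x / R ^ 4) ^ 2 * D' w)) (at x)"
proof -
  have "((\<lambda>x. max 0 (1 - gauge4 x / R ^ 4) ^ 2) has_derivative
     (\<lambda>w. 2 * max 0 (1 - gauge4 x / R ^ 4) * - (dgauge4 x w / R ^ 4))) (at x)"
    using has_derivative_max_0_power[OF has_derivative_one_minus_gauge4[of R x], of 0]
    by (simp add: numeral_eq_Suc)
  from has_derivative_minus[OF has_derivative_mult[OF has_derivative_mult_right[OF this, of "3 / R ^ 4"] assms]]
  show ?thesis
    by (rule has_derivative_eq_rhs) (simp add: fun_eq_iff algebra_simps power_add[of R 4 4, simplified])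
qed

text \<open>Since \<open>dhsq\<close> is bilinear, \<open>dhsq w v\<close> is the derivative of
  \<open>dhsq x v\<close> with respect to \<open>x\<close> in the direction \<open>w\<close>. The
  result is the Hessian of \<open>gauge4\<close>.\<close>

lemma has_derivative_dgauge4:
  "((\<lambda>x. dgauge4 x v) has_derivative
     (\<lambda>w. 2 * dhsq x w * dhsq x v + 2 * hsq x * dhsq w v + 2 * snd (snd w) * snd (snd v))) (at x)"
  unfolding dgauge4_def
  by (auto intro!: derivative_eq_intros has_derivative_hsq simp: fun_eq_iff dhsq_def algebra_simps)

lemma Ck_cutoff:
  assumes "0 < R"
  shows "Ck 2 (cutoff R :: 'n::finite heis \<Rightarrow> real)"
  unfolding numeral_2_eq_2
  apply (subst Ck_Suc_iff[OF has_derivative_cutoff], intro allI)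
  apply (subst Ck_Suc_iff[OF has_derivative_deriv_cutoff[OF has_derivative_dgauge4]], intro allI)
  unfolding Ck.simps dgauge4_def dhsq_def
  by (intro continuous_intros) (use assms in auto)

text \<open>The last factor is the derivative of \<open>gauge4\<close> along
  \<open>X_field i\<close>: the component \<open>2 * \<eta> $ i\<close> of the field contributes the
  product with the last coordinate.\<close>

lemma lie_deriv_X_cutoff:
  "lie_deriv (X_field i) (cutoff R) x =
     - (3 / R ^ 4 * max 0 (1 - gauge4 x / R ^ 4) ^ 2 *
        (4 * hsq x * fst x $ i + 4 * fst (snd x) $ i * snd (snd x)))"
  by (subst lie_deriv_eq[OF has_derivative_cutoff])
    (simp add: X_field_def dgauge4_def dhsq_def inner_axis split: prod.split)

lemma lie_deriv_Y_cutoff: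
  "lie_deriv (Y_field i) (cutoff R) x =
     - (3 / R ^ 4 * max 0 (1 - gauge4 x / R ^ 4) ^ 2 *
        (4 * hsq x * fst (snd x) $ i - 4 * fst x $ i * snd (snd x)))"
  by (subst lie_deriv_eq[OF has_derivative_cutoff])
    (simp add: Y_field_def dgauge4_def dhsq_def inner_axis split: prod.split)

text \<open>The squared factor is the first derivative of \<open>gauge4\<close> along the field, and
  the last factor is the second one. The latter is symmetric in the two horizontal components, so it
  recurs unchanged for \<open>Y_field i\<close>.\<close>

lemma lie_deriv_XX_cutoff:
  "lie_deriv (X_field i) (lie_deriv (X_field i) (cutoff R)) x =
     6 / R ^ 8 * max 0 (1 - gauge4 x / R ^ 4) *
        (4 * hsq x * fst x $ i + 4 * fst (snd x) $ i * snd (snd x))\<^sup>2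
     - 3 / R ^ 4 * max 0 (1 - gauge4 x / R ^ 4) ^ 2 *
        (4 * hsq x + 8 * (fst x $ i)\<^sup>2 + 8 * (fst (snd x) $ i)\<^sup>2)"
proof -
  have D: "((\<lambda>x. 4 * hsq x * fst x $ i + 4 * fst (snd x) $ i * snd (snd x)) has_derivative
    (\<lambda>v. 4 * hsq x * fst v $ i + 4 * dhsq x v * fst x $ i + 4 * fst (snd x) $ i * snd (snd v)
        + 4 * fst (snd v) $ i * snd (snd x))) (at x)"
    by (auto intro!: derivative_eq_intros has_derivative_hsq
        bounded_linear.has_derivative[OF bounded_linear_vec_nth] simp: fun_eq_iff algebra_simps)
  show ?thesis
    unfolding lie_deriv_X_cutoff[abs_def] lie_deriv_eq[OF has_derivative_deriv_cutoff[OF D]]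
    by (cases x) (simp add: X_field_def dgauge4_def dhsq_def inner_axis power2_eq_square
        algebra_simps add_divide_distrib diff_divide_distrib)
qed

lemma lie_deriv_YY_cutoff:
  "lie_deriv (Y_field i) (lie_deriv (Y_field i) (cutoff R)) x =
     6 / R ^ 8 * max 0 (1 - gauge4 x / R ^ 4) *
        (4 * hsq x * fst (snd x) $ i - 4 * fst x $ i * snd (snd x))\<^sup>2
     - 3 / R ^ 4 * max 0 (1 - gauge4 x / R ^ 4) ^ 2 *
        (4 * hsq x + 8 * (fst x $ i)\<^sup>2 + 8 * (fst (snd x) $ i)\<^sup>2)"
proof -
  have D: "((\<lambda>x. 4 * hsq x * fst (snd x) $ i - 4 * fst x $ i * snd (snd x)) has_derivative
    (\<lambda>v. 4 * hsq x * fst (snd v) $ i + 4 * dhsq x v * fst (snd x) $ i - 4 * fst x $ i * snd (snd v)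
        - 4 * fst v $ i * snd (snd x))) (at x)"
    by (auto intro!: derivative_eq_intros has_derivative_hsq
        bounded_linear.has_derivative[OF bounded_linear_vec_nth] simp: fun_eq_iff algebra_simps)
  show ?thesis
    unfolding lie_deriv_Y_cutoff[abs_def] lie_deriv_eq[OF has_derivative_deriv_cutoff[OF D]]
    by (cases x) (simp add: Y_field_def dgauge4_def dhsq_def inner_axis power2_eq_square
        algebra_simps add_divide_distrib diff_divide_distrib)
qed

text \<open>In the sum of the squared first derivatives along \<open>X_field i\<close> and
  \<open>Y_field i\<close> the mixed terms cancel, so the squared horizontal gradient of
  \<open>gauge4\<close> is \<open>16 * hsq x * gauge4 x\<close>. The Kohn Laplacian of
  \<open>gauge4\<close> is \<open>(8 * n + 16) * hsq x\<close> for n = \<open>CARD('n)\<close>.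
  Multiplication by 6 and 3 gives the constants; both terms keep a factor
  \<open>hsq x\<close>.\<close>

lemma kohn_laplacian_cutoff:
  fixes x :: "'n::finite heis"
  shows "kohn_laplacian (cutoff R) x =
     96 / R ^ 8 * max 0 (1 - gauge4 x / R ^ 4) * hsq x * gauge4 x
     - (24 * real CARD('n) + 48) / R ^ 4 * max 0 (1 - gauge4 x / R ^ 4) ^ 2 * hsq x"
proof -
  define H where "H = max 0 (1 - gauge4 x / R ^ 4)"
  define s where "s i = (fst x $ i)\<^sup>2 + (fst (snd x) $ i)\<^sup>2" for i
  have s: "(\<Sum>i\<in>UNIV. s i) = hsq x"
    by (simp add: s_def hsq_def inner_vec_def sum.distrib power2_eq_square)
  have "kohn_laplacian (cutoff R) x =
     (\<Sum>i\<in>UNIV. 96 / R ^ 8 * H * gauge4 x * s i - 24 / R ^ 4 * H\<^sup>2 * hsq x - 48 / R ^ 4 * H\<^sup>2 * s i)"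
    unfolding kohn_laplacian_def lie_deriv_XX_cutoff lie_deriv_YY_cutoff H_def[symmetric]
    by (intro sum.cong refl) (simp add: s_def gauge4_def power2_eq_square algebra_simps add_divide_distrib)
  also have "\<dots> = 96 / R ^ 8 * H * gauge4 x * hsq x
      - real CARD('n) * (24 / R ^ 4 * H\<^sup>2 * hsq x) - 48 / R ^ 4 * H\<^sup>2 * hsq x"
    unfolding sum_subtractf sum_distrib_left[symmetric] s by simp
  finally show ?thesis
    by (simp add: H_def algebra_simps add_divide_distrib)
qed

text \<open>The factor \<open>hsq x / R\<^sup>2\<close> is what makes the weight vanish pointwise as
  \<open>R\<close> grows. It replaces the usual localisation of the derivatives of a cutoff to an
  annulus.\<close>

definition weight :: "real \<Rightarrow> 'n::finite heis \<Rightarrow> real" where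
  "weight R x = hsq x / R\<^sup>2 * indicator {x. gauge4 x \<le> R ^ 4} x"

text \<open>Inside the ball the ratio \<open>a\<close> of \<open>gauge4 x\<close> to
  \<open>R ^ 4\<close> lies in [0, 1], so the two terms are at most 96 and
  \<open>24 * n + 48\<close> times \<open>b\<close>, for n = \<open>CARD('n)\<close>; 144 is 96 +
  48. Outside the ball the truncated factor is 0.\<close>

lemma abs_kohn_laplacian_cutoff_le:
  fixes x :: "'n::finite heis"
  assumes "0 < R"
  shows "\<bar>kohn_laplacian (cutoff R) x\<bar> \<le> (24 * real CARD('n) + 144) * (weight R x / R\<^sup>2)"
proof (cases "gauge4 x \<le> R ^ 4")
  case True
  define a where "a = gauge4 x / R ^ 4"
  have a: "0 \<le> a" "a \<le> 1"
    using True assms by (auto simp: a_def)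
  define b where "b = hsq x / R ^ 4"
  have b: "0 \<le> b" using assms by (simp add: b_def)
  have "kohn_laplacian (cutoff R) x = 96 * ((1 - a) * a) * b - (24 * real CARD('n) + 48) * (1 - a)\<^sup>2 * b"
    using a assms unfolding kohn_laplacian_cutoff a_def[symmetric]
    by (simp add: b_def a_def power_add[of R 4 4, simplified])
  moreover have "weight R x / R\<^sup>2 = b"
    using True by (simp add: weight_def b_def power_add[of R 2 2, simplified])
  moreover have "0 \<le> 96 * ((1 - a) * a) * b" "0 \<le> (24 * real CARD('n) + 48) * (1 - a)\<^sup>2 * b"
    using a b by auto
  moreover have "(1 - a) * a \<le> 1" "(1 - a)\<^sup>2 \<le> 1"
    using a by (auto intro: mult_le_one power_le_one)
  then have "96 * ((1 - a) * a) * b \<le> 96 * 1 * b"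
    "(24 * real CARD('n) + 48) * (1 - a)\<^sup>2 * b \<le> (24 * real CARD('n) + 48) * 1 * b"
    using b by (intro mult_right_mono mult_left_mono; simp)+
  ultimately have "\<bar>kohn_laplacian (cutoff R) x\<bar> \<le> 96 * b + (24 * real CARD('n) + 48) * b"
    by linarith
  with \<open>weight R x / R\<^sup>2 = b\<close> show ?thesis
    by (simp add: algebra_simps)
next
  case False
  then have "max 0 (1 - gauge4 x / R ^ 4) = 0"
    using assms by (simp add: max_def field_simps)
  with False show ?thesis
    by (simp add: kohn_laplacian_cutoff weight_def)
qed

lemma weight_nonneg: "0 \<le> weight R x"
  by (simp add: weight_def)

lemma weight_le:
  assumes "0 < R"
  shows "weight R x \<le> indicator {x. gauge4 x \<le> R ^ 4} x"
proof (cases "gauge4 x \<le> R ^ 4")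
  case True
  then have "(hsq x)\<^sup>2 \<le> (R\<^sup>2)\<^sup>2"
    using hsq_le_gauge4[of x] by (simp flip: power_mult)
  then have "hsq x \<le> R\<^sup>2"
    by (rule power2_le_imp_le) simp
  with True assms show ?thesis
    by (simp add: weight_def)
qed (simp add: weight_def)

lemma weight_le_1: "0 < R \<Longrightarrow> weight R x \<le> 1"
  by (rule order_trans[OF weight_le]) (auto simp: indicator_def)

section \<open>Measurability and the volume of Koranyi balls\<close>

lemma closed_gauge4_ball: "closed {x. gauge4 x \<le> c}"
  by (intro closed_Collect_le continuous_intros)

lemma weight_measurable [measurable]: "weight R \<in> borel_measurable lebesgue"
proof -
  have [measurable]: "hsq \<in> borel_measurable borel"
    by (intro borel_measurable_continuous_onI continuous_intros)
  have [measurable]: "gauge4 \<in> borel_measurable borel"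
    by (intro borel_measurable_continuous_onI continuous_intros)
  have "weight R \<in> borel_measurable borel"
    unfolding weight_def[abs_def] by measurable
  then show ?thesis
    by (intro measurable_completion) simp
qed

lemma cutoff_measurable [measurable]: "cutoff R \<in> borel_measurable lebesgue"
proof -
  have [measurable]: "gauge4 \<in> borel_measurable borel"
    by (intro borel_measurable_continuous_onI continuous_intros)
  have "cutoff R \<in> borel_measurable borel"
    unfolding cutoff_def[abs_def] by measurable
  then show ?thesis
    by (intro measurable_completion) simp
qed

text \<open>The box is anisotropic, with half-side R in the horizontal directions and R^2 in the
  last one, as the dilations prescribe. A cube would give too large a power of R in the volume
  bound.\<close>

lemma gauge4_ball_subset:
  fixes R :: real
  assumes "0 < R"
  shows "{x :: 'n::finite heis. gauge4 x \<le> R ^ 4} \<subseteq>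
     cbox ((\<chi> i. - R), (\<chi> i. - R), - R\<^sup>2) ((\<chi> i. R), (\<chi> i. R), R\<^sup>2)"
proof
  fix x :: "'n heis"
  assume "x \<in> {x. gauge4 x \<le> R ^ 4}"
  then have *: "(hsq x)\<^sup>2 + (snd (snd x))\<^sup>2 \<le> (R\<^sup>2)\<^sup>2"
    by (simp add: gauge4_def flip: power_mult)
  then have "(hsq x)\<^sup>2 \<le> (R\<^sup>2)\<^sup>2"
    using zero_le_power2[of "snd (snd x)"] by linarith
  then have h: "hsq x \<le> R\<^sup>2"
    by (rule power2_le_imp_le) simp
  have "(snd (snd x))\<^sup>2 \<le> (R\<^sup>2)\<^sup>2"
    using * zero_le_power2[of "hsq x"] by linarith
  then have t: "\<bar>snd (snd x)\<bar> \<le> R\<^sup>2"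
    using abs_le_square_iff[of "snd (snd x)" "R\<^sup>2"] by simp
  have "(norm (fst x))\<^sup>2 \<le> R\<^sup>2" "(norm (fst (snd x)))\<^sup>2 \<le> R\<^sup>2"
    using h inner_ge_zero[of "fst x"] inner_ge_zero[of "fst (snd x)"]
    unfolding hsq_def power2_norm_eq_inner by linarith+
  then have "norm (fst x) \<le> R" "norm (fst (snd x)) \<le> R"
    using assms power2_le_imp_le[of "norm (fst x)" R] power2_le_imp_le[of "norm (fst (snd x))" R]
    by linarith+
  then have c: "\<bar>fst x $ i\<bar> \<le> R" "\<bar>fst (snd x) $ i\<bar> \<le> R" for i
    using component_le_norm_cart[of "fst x" i] component_le_norm_cart[of "fst (snd x)" i] by linarith+
  show "x \<in> cbox ((\<chi> i. - R), (\<chi> i. - R), - R\<^sup>2) ((\<chi> i. R), (\<chi> i. R), R\<^sup>2)"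
    using t c by (cases x) (simp add: cbox_Pair_eq mem_box_cart abs_le_iff minus_le_iff[of R] minus_le_iff[of "R\<^sup>2"])
qed

lemma gauge4_ball_lmeasurable:
  assumes "0 < R"
  shows "{x :: 'n::finite heis. gauge4 x \<le> R ^ 4} \<in> lmeasurable"
proof -
  have "bounded {x :: 'n heis. gauge4 x \<le> R ^ 4}"
    using gauge4_ball_subset[OF assms] bounded_cbox bounded_subset by blast
  then show ?thesis
    by (intro lmeasurable_compact) (simp add: compact_eq_bounded_closed closed_gauge4_ball)
qed

text \<open>The enclosing box has 2n sides of length 2R and one of length 2R^2, for n =
  \<open>CARD('n)\<close>, so the exponent of R is the homogeneous dimension Q.\<close>

lemma measure_gauge4_ball_le:
  assumes "0 < R"
  shows "measure lebesgue {x :: 'n::finite heis. gauge4 x \<le> R ^ 4}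
     \<le> 2 ^ (2 * CARD('n) + 1) * R ^ (2 * CARD('n) + 2)"
proof -
  have "measure lebesgue {x :: 'n heis. gauge4 x \<le> R ^ 4}
     \<le> measure lebesgue (cbox ((\<chi> i. - R), (\<chi> i. - R), - R\<^sup>2) ((\<chi> i. R) :: real^'n, (\<chi> i. R) :: real^'n, R\<^sup>2))"
    using gauge4_ball_lmeasurable[OF assms]
    by (intro measure_mono_fmeasurable gauge4_ball_subset assms) (auto intro: fmeasurableD)
  also have "\<dots> = (2 * R) ^ CARD('n) * ((2 * R) ^ CARD('n) * (2 * R\<^sup>2))"
  proof -
    have "measure lborel (cbox (\<chi> i. - R) ((\<chi> i. R) :: real^'n)) = (2 * R) ^ CARD('n)"
      using assms by (subst content_cbox_cart) (auto simp: interval_eq_empty_cart not_less)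
    then show ?thesis
      by (simp add: content_Pair)
  qed
  also have "\<dots> = 2 ^ (2 * CARD('n) + 1) * R ^ (2 * CARD('n) + 2)"
    by (simp add: power_mult_distrib power_add mult_2[of "CARD('n)"] power2_eq_square)
  finally show ?thesis .
qed

section \<open>Admissibility and pointwise limits of the test functions\<close>

lemma cutoff_in_Ck_compact:
  assumes "0 < R"
  shows "(cutoff R :: 'n::finite heis \<Rightarrow> real) \<in> Ck_compact 2"
proof -
  have "{x :: 'n heis. cutoff R x \<noteq> 0} \<subseteq> {x. gauge4 x \<le> R ^ 4}"
    using assms by (auto simp: cutoff_def max_def field_simps split: if_splits)
  then have "closure {x :: 'n heis. cutoff R x \<noteq> 0} \<subseteq> {x. gauge4 x \<le> R ^ 4}"
    by (intro closure_minimal closed_gauge4_ball)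
  then have "bounded (closure {x :: 'n heis. cutoff R x \<noteq> 0})"
    using gauge4_ball_subset[OF assms] bounded_cbox bounded_subset by blast
  then show ?thesis
    by (auto simp: Ck_compact_def compactly_supported_def Ck_cutoff assms compact_eq_bounded_closed)
qed

lemma cutoff_nonneg: "0 \<le> cutoff R x"
  by (simp add: cutoff_def)

lemma cutoff_le_1: "0 < R \<Longrightarrow> cutoff R x \<le> 1"
  unfolding cutoff_def by (intro power_le_one) auto

text \<open>Integer radii turn the limit into one along a sequence, as dominated convergence
  requires; \<open>Suc\<close> keeps them at least 1, as the integral estimate requires.\<close>

lemma tendsto_cutoff: "((\<lambda>k. cutoff (real (Suc k)) x) \<longlonglongrightarrow> 1)"
proof -
  have "(\<lambda>k. max 0 (1 - gauge4 x * (inverse (real (Suc k))) ^ 4) ^ 3) \<longlonglongrightarrow> max 0 (1 - gauge4 x * 0 ^ 4) ^ 3"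
    by (intro tendsto_intros LIMSEQ_inverse_real_of_nat)
  then show ?thesis
    by (simp add: cutoff_def field_simps)
qed

lemma tendsto_weight: "((\<lambda>k. weight (real (Suc k)) x) \<longlonglongrightarrow> 0)"
proof (rule tendsto_sandwich[OF _ _ tendsto_const])
  have "(\<lambda>k. hsq x * (inverse (real (Suc k))) ^ 2) \<longlonglongrightarrow> hsq x * 0 ^ 2"
    by (intro tendsto_intros LIMSEQ_inverse_real_of_nat)
  then show "(\<lambda>k. hsq x * (inverse (real (Suc k))) ^ 2) \<longlonglongrightarrow> 0"
    by simp
  show "\<forall>\<^sub>F k in sequentially. weight (real (Suc k)) x \<le> hsq x * (inverse (real (Suc k))) ^ 2"
    by (auto simp: weight_def indicator_def divide_simps)
qed (auto simp: weight_nonneg)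

section \<open>The integral estimate by Young's inequality\<close>

lemma mult_le_scaled_Young:
  fixes p q s a b :: real
  assumes "1 < p" "1 / p + 1 / q = 1" "0 < s" "0 \<le> a" "0 \<le> b"
  shows "a * b \<le> s powr p * a powr p + s powr (- q) * b powr q"
proof -
  have "1 / p < 1" "0 < 1 / p"
    using assms(1) by auto
  with assms(2) have "1 / q < 1" "0 < 1 / q"
    by linarith+
  then have q: "1 < q"
    by (simp add: field_simps split: if_splits)
  \<comment> \<open>The parameter is split between the factors before Young's inequality; the
    divisors p and q that it produces exceed 1 and are then dropped.\<close>
  have "a * b = (s * a) * (b / s)"
    using assms by simp
  also have "\<dots> \<le> (s * a) powr p / p + (b / s) powr q / q"
    using assms q by (intro Youngs_inequality) auto
  also have "\<dots> \<le> (s * a) powr p + (b / s) powr q"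
    using assms q by (intro add_mono) (simp_all add: divide_le_eq mult_le_cancel_left1)
  also have "\<dots> = s powr p * a powr p + s powr (- q) * b powr q"
    using assms by (simp add: powr_mult powr_divide powr_minus_divide)
  finally show ?thesis .
qed

text \<open>The second term of Young's inequality integrates to at most R^(-2q) times the volume of
  the ball, which is bounded uniformly in R >= 1. Only the first term, through its weight, still
  depends on R.\<close>

lemma integral_abs_mult_kohn_laplacian_cutoff_le:
  fixes u :: "'n::finite heis \<Rightarrow> real"
  assumes p: "1 < p" "p \<le> (2 * real CARD('n) + 2) / (2 * real CARD('n))"
    and q: "q = p / (p - 1)"
    and u: "u \<in> Lp_space p" and R: "1 \<le> R" and s: "0 < s"
  shows "(\<integral>x. \<bar>u x * kohn_laplacian (cutoff R) x\<bar> \<partial>lebesgue) \<le>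
     (24 * real CARD('n) + 144) *
       (s powr p * (\<integral>x. weight R x * \<bar>u x\<bar> powr p \<partial>lebesgue)
        + s powr (- q) * 2 ^ (2 * CARD('n) + 1))"
proof -
  define C where "C = 24 * real CARD('n) + 144"
  define B where "B = {x :: 'n heis. gauge4 x \<le> R ^ 4}"
  have R0: "0 < R" using R by simp
  have conj: "1 / p + 1 / q = 1"
    using p unfolding q by (simp add: diff_divide_distrib)
  have [measurable]: "u \<in> borel_measurable lebesgue"
    and int: "integrable lebesgue (\<lambda>x. \<bar>u x\<bar> powr p)"
    using u by (auto simp: Lp_space_def)
  have wint: "integrable lebesgue (\<lambda>x. weight R x * \<bar>u x\<bar> powr p)"
  proof (rule Bochner_Integration.integrable_bound[OF int])
    show "AE x in lebesgue. norm (weight R x * \<bar>u x\<bar> powr p) \<le> norm (\<bar>u x\<bar> powr p)"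
      by (auto simp: abs_mult weight_nonneg weight_le_1 R0 intro!: mult_left_le_one_le)
  qed measurable
  have Bm: "B \<in> lmeasurable"
    unfolding B_def by (rule gauge4_ball_lmeasurable[OF R0])
  then have Bint: "integrable lebesgue (\<lambda>x. indicator B x :: real)"
    by (auto simp: fmeasurable_def intro!: integrable_real_indicator)
  have pw: "\<bar>u x * kohn_laplacian (cutoff R) x\<bar> \<le>
      C * (s powr p * (weight R x * \<bar>u x\<bar> powr p) + s powr (- q) * R powr (- (2 * q)) * indicator B x)"
    for x
  proof -
    have "\<bar>u x * kohn_laplacian (cutoff R) x\<bar> \<le> \<bar>u x\<bar> * (C * (weight R x / R\<^sup>2))"
      unfolding abs_mult C_def
      by (intro mult_left_mono abs_kohn_laplacian_cutoff_le R0) simp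
    \<comment> \<open>Young's inequality is applied to |u| and R^(-2) only. The weight stays
      outside, so that it survives next to |u|^p.\<close>
    also have "\<dots> = C * (weight R x * (\<bar>u x\<bar> * R powr (-2)))"
      using R0 by (simp add: powr_minus divide_inverse)
    also have "\<dots> \<le> C * (weight R x * (s powr p * \<bar>u x\<bar> powr p + s powr (- q) * (R powr (-2)) powr q))"
      using p conj s by (intro mult_left_mono mult_le_scaled_Young weight_nonneg)
        (auto simp: C_def)
    also have "\<dots> = C * (s powr p * (weight R x * \<bar>u x\<bar> powr p) + s powr (- q) * R powr (- (2 * q)) * weight R x)"
      by (simp add: powr_powr algebra_simps)
    \<comment> \<open>In the term without u the weight is replaced by the indicator of the ball,
      whose integral is the volume.\<close>
    also have "\<dots> \<le> C * (s powr p * (weight R x * \<bar>u x\<bar> powr p) + s powr (- q) * R powr (- (2 * q)) * indicator B x)"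
      using weight_le[OF R0, of x] by (intro mult_left_mono add_left_mono) (auto simp: C_def B_def)
    finally show ?thesis .
  qed
  have "(\<integral>x. \<bar>u x * kohn_laplacian (cutoff R) x\<bar> \<partial>lebesgue) \<le>
     (\<integral>x. C * (s powr p * (weight R x * \<bar>u x\<bar> powr p) + s powr (- q) * R powr (- (2 * q)) * indicator B x) \<partial>lebesgue)"
    \<comment> \<open>Only the majorant has to be integrable and nonnegative here: a non-integrable
      left side would have integral 0 by convention.\<close>
    using wint Bint by (intro integral_mono' pw) (auto simp: C_def weight_nonneg)
  also have "\<dots> = C * (s powr p * (\<integral>x. weight R x * \<bar>u x\<bar> powr p \<partial>lebesgue)
       + s powr (- q) * (R powr (- (2 * q)) * measure lebesgue B))"
    using wint Bint by simp
  also have "R powr (- (2 * q)) * measure lebesgue B \<le> 2 ^ (2 * CARD('n) + 1)"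
  proof -
    have n: "0 < real CARD('n)" by simp
    \<comment> \<open>This is the hypothesis p <= Q / (Q - 2) restated for the conjugate exponent as
      Q <= 2q, with equality in the critical case.\<close>
    have "2 * real CARD('n) + 2 \<le> 2 * q"
      using p n unfolding q by (simp add: field_simps)
    then have "R powr (real (2 * CARD('n) + 2)) \<le> R powr (2 * q)"
      using R by (intro powr_mono) auto
    then have *: "R ^ (2 * CARD('n) + 2) \<le> R powr (2 * q)"
      using R0 by (subst (asm) powr_realpow) auto
    have "measure lebesgue B \<le> 2 ^ (2 * CARD('n) + 1) * R ^ (2 * CARD('n) + 2)"
      unfolding B_def by (rule measure_gauge4_ball_le[OF R0])
    also have "\<dots> \<le> 2 ^ (2 * CARD('n) + 1) * R powr (2 * q)"
      by (intro mult_left_mono *) simp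
    finally show ?thesis
      using R0 by (simp add: powr_minus field_simps)
  qed
  finally show ?thesis
    by (simp add: C_def mult_left_mono)
qed

section \<open>Nonexistence by passing to the limit\<close>

theorem theorem2p2:
  fixes M :: "real \<Rightarrow> real \<Rightarrow> real" and C\<^sub>0 p Q :: real
  assumes "Q = 2 * real CARD('n::finite) + 2"
    and "\<And>s t. 0 \<le> s \<Longrightarrow> 0 \<le> t \<Longrightarrow> 0 < M s t \<and> M s t \<le> C\<^sub>0"
    and "1 < p" and "p \<le> Q / (Q - 2)"
  shows "\<nexists>u :: 'n heis \<Rightarrow> real.
           kirchhoff_weak_solution M p u \<and> \<not> (AE x in lebesgue. u x = 0)"
proof (intro notI, elim exE conjE)
  fix u :: "'n heis \<Rightarrow> real"
  assume sol: "kirchhoff_weak_solution M p u" and nontriv: "\<not> (AE x in lebesgue. u x = 0)"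
  \<comment> \<open>For a fixed solution the nonlocal coefficient is just a number. It is positive
    because both arguments are integrals of squares, hence in the range where \<open>M\<close> is
    controlled.\<close>
  define m where "m = M (\<integral>y. (norm (weak_hgrad u y))\<^sup>2 \<partial>lebesgue) (\<integral>y. \<bar>weak_kohn_laplacian u y\<bar>\<^sup>2 \<partial>lebesgue)"
  define q where "q = p / (p - 1)"
  define C where "C = 24 * real CARD('n) + 144"
  define c :: real where "c = 2 ^ (2 * CARD('n) + 1)"
  define I where "I = (\<integral>x. \<bar>u x\<bar> powr p \<partial>lebesgue)"
  have m: "0 < m"
    unfolding m_def by (intro conjunct1[OF assms(2)] Bochner_Integration.integral_nonneg) auto
  have q: "0 < q"
    using assms(3) by (simp add: q_def)
  have u: "u \<in> Lp_space p"
    using sol by (simp add: kirchhoff_weak_solution_def)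
  have [measurable]: "u \<in> borel_measurable lebesgue"
    and int: "integrable lebesgue (\<lambda>x. \<bar>u x\<bar> powr p)"
    using u by (auto simp: Lp_space_def)
  have test: "(\<integral>x. \<bar>u x\<bar> powr p * cutoff R x \<partial>lebesgue)
      \<le> m * (C * (s powr p * (\<integral>x. weight R x * \<bar>u x\<bar> powr p \<partial>lebesgue) + s powr (- q) * c))"
    if "1 \<le> R" "0 < s" for R s
  proof -
    have "(\<integral>x. \<bar>u x\<bar> powr p * cutoff R x \<partial>lebesgue)
       = - (\<integral>x. m * u x * kohn_laplacian (cutoff R) x \<partial>lebesgue)"
      using sol cutoff_in_Ck_compact[of R] that
      by (auto simp: kirchhoff_weak_solution_def m_def cutoff_nonneg)
    also have "\<dots> = m * - (\<integral>x. u x * kohn_laplacian (cutoff R) x \<partial>lebesgue)"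
      by (simp add: mult.assoc)
    also have "\<dots> \<le> m * (\<integral>x. \<bar>u x * kohn_laplacian (cutoff R) x\<bar> \<partial>lebesgue)"
      using m integral_norm_bound[of lebesgue "\<lambda>x. u x * kohn_laplacian (cutoff R) x"]
      by (intro mult_left_mono) (auto simp: abs_le_iff)
    also have "\<dots> \<le> m * (C * (s powr p * (\<integral>x. weight R x * \<bar>u x\<bar> powr p \<partial>lebesgue) + s powr (- q) * c))"
      using m assms(1,3,4) u that q_def unfolding C_def c_def
      by (intro mult_left_mono integral_abs_mult_kohn_laplacian_cutoff_le) auto
    finally show ?thesis .
  qed
  \<comment> \<open>Both this limit and the next are dominated by |u|^p, since the cutoff and the
    weight take values in [0, 1].\<close>
  have lim1: "(\<lambda>k. \<integral>x. \<bar>u x\<bar> powr p * cutoff (real (Suc k)) x \<partial>lebesgue) \<longlonglongrightarrow> I"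
    unfolding I_def
  proof (rule integral_dominated_convergence[OF _ _ int])
    show "AE x in lebesgue. (\<lambda>k. \<bar>u x\<bar> powr p * cutoff (real (Suc k)) x) \<longlonglongrightarrow> \<bar>u x\<bar> powr p"
      using tendsto_mult[OF tendsto_const tendsto_cutoff] by fastforce
    show "AE x in lebesgue. norm (\<bar>u x\<bar> powr p * cutoff (real (Suc k)) x) \<le> \<bar>u x\<bar> powr p" for k
      by (auto simp: abs_mult cutoff_nonneg cutoff_le_1 intro!: mult_right_le_one_le)
  qed measurable
  have lim2: "(\<lambda>k. \<integral>x. weight (real (Suc k)) x * \<bar>u x\<bar> powr p \<partial>lebesgue) \<longlonglongrightarrow> (\<integral>x. 0 \<partial>(lebesgue :: 'n heis measure))"
  proof (rule integral_dominated_convergence[OF _ _ int])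
    show "AE x in lebesgue. (\<lambda>k. weight (real (Suc k)) x * \<bar>u x\<bar> powr p) \<longlonglongrightarrow> 0"
      using tendsto_mult[OF tendsto_weight tendsto_const] by fastforce
    show "AE x in lebesgue. norm (weight (real (Suc k)) x * \<bar>u x\<bar> powr p) \<le> \<bar>u x\<bar> powr p" for k
      by (auto simp: abs_mult weight_nonneg weight_le_1 intro!: mult_left_le_one_le)
  qed measurable
  \<comment> \<open>With \<open>s\<close> fixed, the growing radius removes the term carrying
    \<open>s powr p\<close>, however large that factor is. What remains decreases in
    \<open>s\<close>, so \<open>s\<close> may be sent to infinity afterwards.\<close>
  have bound: "I \<le> m * (C * (s powr (- q) * c))" if "0 < s" for s
  proof -
    have "I \<le> m * (C * (s powr p * (\<integral>x. 0 \<partial>(lebesgue :: 'n heis measure)) + s powr (- q) * c))"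
      by (rule LIMSEQ_le[OF lim1 tendsto_mult[OF tendsto_const tendsto_mult[OF tendsto_const
        tendsto_add[OF tendsto_mult[OF tendsto_const lim2] tendsto_const]]]])
        (use test that in auto)
    then show ?thesis by simp
  qed
  have "I \<le> m * (C * (0 * c))"
  proof (rule tendsto_lowerbound)
    show "((\<lambda>s. m * (C * (s powr (- q) * c))) \<longlongrightarrow> m * (C * (0 * c))) at_top"
      using q by (intro tendsto_intros tendsto_neg_powr filterlim_ident) auto
    show "\<forall>\<^sub>F s in at_top. I \<le> m * (C * (s powr (- q) * c))"
      using eventually_gt_at_top[of 0] by eventually_elim (rule bound)
  qed simp
  moreover have "0 \<le> I"
    unfolding I_def by (intro Bochner_Integration.integral_nonneg) auto
  ultimately have "I = 0" by simp
  then have "AE x in lebesgue. \<bar>u x\<bar> powr p = 0"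
    using integral_nonneg_eq_0_iff_AE[OF int] by (simp add: I_def)
  then have "AE x in lebesgue. u x = 0"
    by simp
  with nontriv show False by contradiction
qed

end
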